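(* Let $N\ge 1$ and let $$D_N=\begin{pmatrix} a_0&b_0&a_1&b_1&\ldots&a_{N-1}&b_{N-1}\\ -b_{N-1}&a_{N-1}&-b_{N-2}&a_{N-2}&\ldots&-b_0&a_0\end{pmatrix}$$ be a Daubechies wavelet matrix, i.e. a real matrix of this form satisfying the quadratic condition, the linear condition, and having polynomial-regularity degree $N-1$ (see context). Then for every $\varepsilon>0$ there exist rational numbers $\hat a_0,\ldots,\hat a_{N-1},\hat b_0,\ldots,\hat b_{N-1}$ with $|\hat a_k-a_k|<\varepsilon$ and $|\hat b_k-b_k|<\varepsilon$ for all $k=0,\ldots,N-1$, such that the matrix $$\hat D_N=\begin{pmatrix} \hat a_0&\hat b_0&\hat a_1&\hat b_1&\ldots&\hat a_{N-1}&\hat b_{N-1}\\ -\hat b_{N-1}&\hat a_{N-1}&-\hat b_{N-2}&\hat a_{N-2}&\ldots&-\hat b_0&\hat a_0\end{pmatrix}$$ satisfies the quadratic condition and the linear condition exactly.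
   Context: For a real $2\times 2N$ matrix with rows $h_0,h_1$, whose entries are denoted $h_j[k]$, $j=0,1$, $k=0,\ldots,2N-1$, put $h_j(z)=\sum_{k=0}^{2N-1}h_j[k]z^k$. For a matrix of the form displayed in the claim (the second row being determined by the first as shown), so that $h_0[2k]=a_k$ and $h_0[2k+1]=b_k$: - the quadratic condition is $|h_0(z)|^2+|h_0(-z)|^2=4$ for all $z\in\mathbb{C}$ with $|z|=1$ (this is the condition that makes the filter bank a perfect reconstruction filter bank); - the linear condition is $h_0(1)=2$ and $h_1(1)=0$; - polynomial-regularity degree $N-1$ means $\sum_{k=0}^{2N-1}h_1[k]\,k^p=0$ for $p=0,1,\ldots,N-1$ (with $0^0=1$). *)

theory Defs
  imports Complex_Main "Jordan_Normal_Form.Matrix"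
begin

definition row_symbol :: "real mat \<Rightarrow> nat \<Rightarrow> complex \<Rightarrow> complex" where
  "row_symbol H j z = (\<Sum>k<dim_col H. complex_of_real (H $$ (j, k)) * z ^ k)"

definition quadratic_condition :: "real mat \<Rightarrow> bool" where
  "quadratic_condition H \<longleftrightarrow>
     (\<forall>z. cmod z = 1 \<longrightarrow> (cmod (row_symbol H 0 z))\<^sup>2 + (cmod (row_symbol H 0 (- z)))\<^sup>2 = 4)"

definition linear_condition :: "real mat \<Rightarrow> bool" where
  "linear_condition H \<longleftrightarrow> row_symbol H 0 1 = 2 \<and> row_symbol H 1 1 = 0"

definition polynomial_regularity :: "real mat \<Rightarrow> nat \<Rightarrow> bool" where
  "polynomial_regularity H m \<longleftrightarrow>
     (\<forall>p\<le>m. (\<Sum>k<dim_col H. H $$ (1, k) * real k ^ p) = 0)"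

(* The 2 x 2N matrix with first row a_0, b_0, ..., a_(N-1), b_(N-1) and second row
   -b_(N-1), a_(N-1), ..., -b_0, a_0.  Only the values of a and b below N enter. *)
definition wavelet_matrix :: "nat \<Rightarrow> (nat \<Rightarrow> real) \<Rightarrow> (nat \<Rightarrow> real) \<Rightarrow> real mat" where
  "wavelet_matrix N a b = mat 2 (2 * N) (\<lambda>(j, k).
     if j = 0 then (if even k then a (k div 2) else b (k div 2))
     else (if even k then - b (N - 1 - k div 2) else a (N - 1 - k div 2)))"

end

theory Submission
  imports Defs "HOL-Computational_Algebra.Polynomial"
begin

text \<open>
  Write \<open>h\<^sub>0(z) = A(z\<^sup>2) + z B(z\<^sup>2)\<close>. The quadratic condition says that the vector polynomial
  \<open>v = (A, B)\<close> satisfies \<open>|v|\<^sup>2 = 2\<close> on the unit circle, and the linear condition that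
  \<open>v(1) = (1, 1)\<close>. If \<open>v\<close> has degree \<open>M > 0\<close> and leading coefficient \<open>u\<close>, then \<open>u\<close> is orthogonal
  to \<open>v(0)\<close>, so \<open>v(z) = (P + z Q) w(z)\<close> where \<open>Q\<close> is the orthogonal projection onto the line of \<open>u\<close>,
  \<open>P = 1 - Q\<close>, and \<open>w\<close> has degree less than \<open>M\<close>. Both \<open>|w|\<close> on the circle and \<open>w(1)\<close> agree with
  those of \<open>v\<close>. By induction \<open>w\<close> is a limit of rational solutions, and replacing \<open>u\<close> by rational
  vectors tending to it gives rational solutions tending to \<open>v\<close>, since \<open>Q = u u\<^sup>T / |u|\<^sup>2\<close>
  is rational for rational \<open>u\<close>.
\<close>

section \<open>Polynomial pairs and the degree-one factor\<close>

definition symbol :: "nat \<Rightarrow> (nat \<Rightarrow> real) \<Rightarrow> complex \<Rightarrow> complex" where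
  "symbol N a z = (\<Sum>k<N. of_real (a k) * z ^ k)"

text \<open>Forcing the coefficients from \<open>N\<close> on to vanish makes identities such as the
  one for \<open>shift\<close> hold at every index and lets the length change without altering
  \<open>a\<close> and \<open>b\<close>.\<close>

definition wavelet_pair :: "nat \<Rightarrow> (nat \<Rightarrow> real) \<Rightarrow> (nat \<Rightarrow> real) \<Rightarrow> bool" where
  "wavelet_pair N a b \<longleftrightarrow>
     (\<forall>k\<ge>N. a k = 0 \<and> b k = 0) \<and>
     (\<forall>z. cmod z = 1 \<longrightarrow> (cmod (symbol N a z))\<^sup>2 + (cmod (symbol N b z))\<^sup>2 = 2) \<and>
     symbol N a 1 = 1 \<and> symbol N b 1 = 1"

lemma symbol_cong: "(\<And>k. k < N \<Longrightarrow> a k = a' k) \<Longrightarrow> symbol N a z = symbol N a' z"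
  by (simp add: symbol_def)

lemma symbol_lincomb:
  "symbol N (\<lambda>k. r * a k + s * b k) z = of_real r * symbol N a z + of_real s * symbol N b z"
  by (simp add: symbol_def sum.distrib sum_distrib_left algebra_simps)

lemma symbol_Suc_zero: "a N = 0 \<Longrightarrow> symbol (Suc N) a z = symbol N a z"
  by (simp add: symbol_def)

definition shift :: "(nat \<Rightarrow> real) \<Rightarrow> nat \<Rightarrow> real" where
  "shift a k = (case k of 0 \<Rightarrow> 0 | Suc j \<Rightarrow> a j)"

lemma shift_simps [simp]: "shift a 0 = 0" "shift a (Suc k) = a k"
  by (simp_all add: shift_def)

lemma symbol_shift: "symbol (Suc N) (shift a) z = z * symbol N a z"
  by (simp add: symbol_def sum.lessThan_Suc_shift sum_distrib_left algebra_simps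
      del: sum.lessThan_Suc)

text \<open>The vectors (-y, x) and (x, y) are orthogonal and equally long, so the cross terms
  cancel.\<close>

lemma cmod_rotate:
  "(cmod (of_real (- y) * s + of_real x * t))\<^sup>2 + (cmod (of_real x * s + of_real y * t))\<^sup>2
     = (x\<^sup>2 + y\<^sup>2) * ((cmod s)\<^sup>2 + (cmod t)\<^sup>2)"
  unfolding cmod_power2 by (simp add: power2_eq_square algebra_simps)

text \<open>With \<open>u = (x, y)\<close> and \<open>u' = (-y, x)\<close>, the right-hand pair is \<open>w = \<alpha> u' + \<beta> u\<close> and the
  left-hand pair is \<open>(P + z Q) w = \<alpha> u' + z \<beta> u\<close>.\<close>

lemma wavelet_pair_shift_iff:
  assumes "\<And>k. k \<ge> M \<Longrightarrow> \<alpha> k = 0" "\<And>k. k \<ge> M \<Longrightarrow> \<beta> k = 0"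
  shows "wavelet_pair (Suc M) (\<lambda>k. (- y) * \<alpha> k + x * shift \<beta> k) (\<lambda>k. x * \<alpha> k + y * shift \<beta> k)
     \<longleftrightarrow> wavelet_pair M (\<lambda>k. (- y) * \<alpha> k + x * \<beta> k) (\<lambda>k. x * \<alpha> k + y * \<beta> k)"
proof -
  have supp: "\<alpha> k = 0 \<and> shift \<beta> k = 0" if "k \<ge> Suc M" for k
    using that assms by (cases k) auto
  have \<alpha>: "symbol (Suc M) \<alpha> z = symbol M \<alpha> z" for z
    using assms by (simp add: symbol_Suc_zero)
  \<comment> \<open>By \<open>cmod_rotate\<close> the norms depend only on the moduli of the two
    symbols, which the factor z preserves on the unit circle; at 1 this factor is 1.\<close>
  show ?thesis
    unfolding wavelet_pair_def symbol_lincomb symbol_shift \<alpha> cmod_rotate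
    using assms supp by (auto simp: norm_mult)
qed

section \<open>Orthogonality of the first and last coefficients\<close>

lemma infinite_unit_circle: "infinite {z :: complex. cmod z = 1}"
proof
  assume fin: "finite {z :: complex. cmod z = 1}"
  \<comment> \<open>All \<open>m\<close> roots of unity of order \<open>m\<close> lie on the circle,
    one more than its supposed cardinality.\<close>
  define m where "m = Suc (card {z :: complex. cmod z = 1})"
  have "{z :: complex. z ^ m = 1} \<subseteq> {z. cmod z = 1}"
    using power_eq_1_iff by (auto simp: m_def simp del: power_Suc)
  then have "card {z :: complex. z ^ m = 1} < m"
    using card_mono[OF fin] by (simp add: m_def less_Suc_eq_le)
  moreover have "card {z :: complex. z ^ m = 1} = m"
    by (rule card_roots_unity_eq) (simp add: m_def)
  ultimately show False by simp
qed

text \<open>The coefficient of \<open>z\<^sup>0\<close> in \<open>z\<^sup>M (|A(z)|\<^sup>2 + |B(z)|\<^sup>2) = 2 z\<^sup>M\<close>, an identity between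
  polynomials because \<open>z\<^sup>M\<close> times the conjugate of \<open>A(z)\<close> is the reversed polynomial on the circle.\<close>

lemma wavelet_pair_ends_orthogonal:
  assumes "wavelet_pair (Suc M) a b" "M > 0"
  shows "a 0 * a M + b 0 * b M = 0"
proof -
  define p where "p c = (\<Sum>k<Suc M. monom (complex_of_real (c k)) k)" for c
  define r where "r c = p (\<lambda>k. c (M - k))" for c
  have coeff_p: "coeff (p c) 0 = c 0" for c
    by (simp add: p_def coeff_sum sum.lessThan_Suc_shift del: sum.lessThan_Suc)
  have poly_p: "poly (p c) z = symbol (Suc M) c z" for c z
    unfolding p_def symbol_def by (simp add: poly_sum poly_monom)
  have poly_r: "poly (r c) z = z ^ M * cnj (symbol (Suc M) c z)" if z: "cmod z = 1" for c z
  proof -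
    have zz: "z * cnj z = 1"
      using z complex_norm_square[of z] by simp
    have "z ^ M * cnj (symbol (Suc M) c z) = (\<Sum>k<Suc M. of_real (c k) * (z ^ M * cnj z ^ k))"
      unfolding symbol_def cnj_sum sum_distrib_left by (simp add: algebra_simps)
    also have "\<dots> = (\<Sum>k<Suc M. of_real (c k) * z ^ (M - k))"
    proof (rule sum.cong[OF refl])
      fix k assume "k \<in> {..<Suc M}"
      then have "z ^ M * cnj z ^ k = z ^ (M - k) * (z * cnj z) ^ k"
        by (simp add: power_mult_distrib mult.assoc[symmetric] power_add[symmetric])
      then show "of_real (c k) * (z ^ M * cnj z ^ k) = of_real (c k) * z ^ (M - k)"
        by (simp add: zz)
    qed
    also have "\<dots> = (\<Sum>k<Suc M. of_real (c (M - k)) * z ^ (M - (M - k)))"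
      by (subst sum.nat_diff_reindex[symmetric]) simp
    also have "\<dots> = poly (r c) z"
      unfolding r_def poly_p symbol_def by (rule sum.cong) auto
    finally show ?thesis by simp
  qed
  define q where "q = p a * r a + p b * r b - monom 2 M"
  have "poly q z = 0" if z: "cmod z = 1" for z
  proof -
    have sq: "s * (z ^ M * cnj s) = z ^ M * of_real ((cmod s)\<^sup>2)" for s
      by (simp only: complex_norm_square mult_ac)
    have "poly q z = z ^ M * (of_real ((cmod (symbol (Suc M) a z))\<^sup>2
        + (cmod (symbol (Suc M) b z))\<^sup>2) - 2)"
      unfolding q_def
      by (simp only: poly_diff poly_add poly_mult poly_monom poly_r[OF z])
        (simp only: poly_p sq of_real_add, simp add: algebra_simps)
    also have "\<dots> = 0"
      using assms(1) z by (simp add: wavelet_pair_def)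
    finally show ?thesis .
  qed
  then have "{z. cmod z = 1} \<subseteq> {z. poly q z = 0}" by auto
  then have "q = 0"
    using infinite_unit_circle poly_roots_finite finite_subset by blast
  then have "coeff q 0 = 0" by simp
  \<comment> \<open>The constant term of \<open>r a\<close> is \<open>a M\<close>, and that of
    \<open>monom 2 M\<close> vanishes because \<open>M > 0\<close>.\<close>
  then have "complex_of_real (a 0 * a M + b 0 * b M) = 0"
    using \<open>M > 0\<close> by (simp add: q_def coeff_mult_0 r_def coeff_p)
  then show ?thesis by (simp only: of_real_eq_0_iff)
qed

section \<open>Rational approximation of pairs\<close>

lemma rational_sequence:
  obtains q :: "nat \<Rightarrow> real" where "\<And>n. q n \<in> \<rat>" "q \<longlonglongrightarrow> x"
proof -
  have "\<exists>r\<in>\<rat>. x < r \<and> r < x + inverse (real (Suc n))" for n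
    by (rule Rats_dense_in_real) simp
  then obtain q where q: "\<And>n. q n \<in> \<rat>" "\<And>n. x < q n" "\<And>n. q n < x + inverse (real (Suc n))"
    by metis
  have "q \<longlonglongrightarrow> x"
  proof (rule tendsto_sandwich[of "\<lambda>_. x"])
    show "(\<lambda>n. x + inverse (real (Suc n))) \<longlonglongrightarrow> x"
      using tendsto_add[OF tendsto_const LIMSEQ_inverse_real_of_nat, of x] by simp
  qed (use less_imp_le[OF q(2)] less_imp_le[OF q(3)] in simp_all)
  with q(1) show thesis by (rule that)
qed

text \<open>The pair condition is only required eventually, because the rational approximations of \<open>u\<close>
  may vanish for small indices.\<close>

lemma wavelet_pair_rational_sequence:
  assumes "wavelet_pair N a b"
  shows "\<exists>a' b'. (\<forall>\<^sub>F n in sequentially. wavelet_pair N (a' n) (b' n)) \<and>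
    (\<forall>n k. a' n k \<in> \<rat> \<and> b' n k \<in> \<rat>) \<and>
    (\<forall>k. (\<lambda>n. a' n k) \<longlonglongrightarrow> a k \<and> (\<lambda>n. b' n k) \<longlonglongrightarrow> b k)"
  using assms
proof (induction N arbitrary: a b)
  case 0
  then show ?case by (simp add: wavelet_pair_def symbol_def)
next
  case (Suc M)
  have supp: "a k = 0" "b k = 0" if "k \<ge> Suc M" for k
    using Suc.prems that by (auto simp: wavelet_pair_def)
  \<comment> \<open>Either the length can be lowered, or the pair is constant and hence (1, 1), or
    the leading vector u is nonzero and a factor splits off.\<close>
  consider "a M = 0" "b M = 0" | "M = 0" | "M > 0" "(a M)\<^sup>2 + (b M)\<^sup>2 \<noteq> 0"
    by (auto simp: sum_power2_eq_zero_iff)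
  then show ?case
  proof cases
    case 1
    have mono: "wavelet_pair (Suc M) c d" if "wavelet_pair M c d" for c d
      using that by (auto simp: wavelet_pair_def symbol_Suc_zero)
    have "a k = 0 \<and> b k = 0" if "k \<ge> M" for k
      using that 1 supp by (cases "k = M") auto
    then have "wavelet_pair M a b"
      using Suc.prems 1 by (auto simp: wavelet_pair_def symbol_Suc_zero)
    from Suc.IH[OF this] obtain a' b' where
      "\<forall>\<^sub>F n in sequentially. wavelet_pair M (a' n) (b' n)" and
      approx: "\<forall>n k. a' n k \<in> \<rat> \<and> b' n k \<in> \<rat>"
        "\<forall>k. (\<lambda>n. a' n k) \<longlonglongrightarrow> a k \<and> (\<lambda>n. b' n k) \<longlonglongrightarrow> b k"
      by blast
    then have "\<forall>\<^sub>F n in sequentially. wavelet_pair (Suc M) (a' n) (b' n)"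
      by (auto elim: eventually_mono intro: mono)
    with approx show ?thesis by blast
  next
    case 2
    have "a 0 = 1" "b 0 = 1"
      using Suc.prems 2 by (simp_all add: wavelet_pair_def symbol_def)
    then have "a k \<in> \<rat> \<and> b k \<in> \<rat>" for k
      using supp 2 by (cases k) auto
    then show ?thesis
      using Suc.prems by (intro exI[of _ "\<lambda>_. a"] exI[of _ "\<lambda>_. b"]) simp
  next
    case 3
    define x y where "x = a M" and "y = b M"
    \<comment> \<open>Coordinates of the coefficients of v along (-y, x) and u = (x, y); the index
      \<open>Suc k\<close> in \<open>\<beta>\<close> divides the component along u by z.\<close>
    define \<alpha> where "\<alpha> k = (- y * a k + x * b k) / (x\<^sup>2 + y\<^sup>2)" for k
    define \<beta> where "\<beta> k = (x * a (Suc k) + y * b (Suc k)) / (x\<^sup>2 + y\<^sup>2)" for k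
    define c where "c k = (- y) * \<alpha> k + x * \<beta> k" for k
    define d where "d k = x * \<alpha> k + y * \<beta> k" for k
    have nz: "x\<^sup>2 + y\<^sup>2 \<noteq> 0"
      using 3 by (simp add: x_def y_def)
    have orth: "x * a 0 + y * b 0 = 0"
      using wavelet_pair_ends_orthogonal[OF Suc.prems] 3 by (simp add: x_def y_def mult.commute)
    have coords: "(- y) * ((- y * s + x * t) / (x\<^sup>2 + y\<^sup>2)) + x * ((x * s + y * t) / (x\<^sup>2 + y\<^sup>2)) = s"
      "x * ((- y * s + x * t) / (x\<^sup>2 + y\<^sup>2)) + y * ((x * s + y * t) / (x\<^sup>2 + y\<^sup>2)) = t"
      if "x\<^sup>2 + y\<^sup>2 \<noteq> 0" for s t x y :: real
      using that by (simp_all add: divide_simps) (auto simp: algebra_simps power2_eq_square)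
    \<comment> \<open>Index 0 needs \<open>orth\<close>: v(0) has no component along u, so dividing
      by z loses nothing.\<close>
    have \<beta>_shift: "shift \<beta> k = (x * a k + y * b k) / (x\<^sup>2 + y\<^sup>2)" for k
      using orth by (cases k) (simp_all add: \<beta>_def)
    have ab: "a k = (- y) * \<alpha> k + x * shift \<beta> k" "b k = x * \<alpha> k + y * shift \<beta> k" for k
      unfolding \<beta>_shift \<alpha>_def using coords[OF nz] by auto
    \<comment> \<open>The coefficient at \<open>M\<close> is u itself, which has no component along
      (-y, x); this is why w is shorter than v.\<close>
    have \<alpha>0: "\<alpha> k = 0" if "k \<ge> M" for k
      using that supp[of k] by (cases "k = M") (auto simp: \<alpha>_def x_def y_def)
    have \<beta>0: "\<beta> k = 0" if "k \<ge> M" for k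
      using that supp[of "Suc k"] by (simp add: \<beta>_def)
    have "wavelet_pair (Suc M) (\<lambda>k. (- y) * \<alpha> k + x * shift \<beta> k)
        (\<lambda>k. x * \<alpha> k + y * shift \<beta> k)"
      using Suc.prems unfolding ab[symmetric] .
    then have "wavelet_pair M c d"
      unfolding c_def d_def by (subst (asm) wavelet_pair_shift_iff) (use \<alpha>0 \<beta>0 in auto)
    from Suc.IH[OF this] obtain c' d' where
      pair': "\<forall>\<^sub>F n in sequentially. wavelet_pair M (c' n) (d' n)" and
      rat': "\<And>n k. c' n k \<in> \<rat>" "\<And>n k. d' n k \<in> \<rat>" and
      lim': "\<And>k. (\<lambda>n. c' n k) \<longlonglongrightarrow> c k" "\<And>k. (\<lambda>n. d' n k) \<longlonglongrightarrow> d k"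
      by blast
    obtain x' where x': "\<And>n. x' n \<in> \<rat>" "x' \<longlonglongrightarrow> x" by (rule rational_sequence) blast
    obtain y' where y': "\<And>n. y' n \<in> \<rat>" "y' \<longlonglongrightarrow> y" by (rule rational_sequence) blast
    \<comment> \<open>The approximation of w is decomposed along the approximation of u, not along
      u, so that multiplying by the rational factor gives an exact pair.\<close>
    define \<alpha>' where "\<alpha>' n k = (- y' n * c' n k + x' n * d' n k) / ((x' n)\<^sup>2 + (y' n)\<^sup>2)" for n k
    define \<beta>' where "\<beta>' n k = (x' n * c' n k + y' n * d' n k) / ((x' n)\<^sup>2 + (y' n)\<^sup>2)" for n k
    define a' where "a' n k = (- y' n) * \<alpha>' n k + x' n * shift (\<beta>' n) k" for n k
    define b' where "b' n k = x' n * \<alpha>' n k + y' n * shift (\<beta>' n) k" for n k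
    have "(\<lambda>n. (x' n)\<^sup>2 + (y' n)\<^sup>2) \<longlonglongrightarrow> x\<^sup>2 + y\<^sup>2"
      by (intro tendsto_intros x' y')
    then have "\<forall>\<^sub>F n in sequentially. (x' n)\<^sup>2 + (y' n)\<^sup>2 \<noteq> 0"
      using nz by (rule tendsto_imp_eventually_ne)
    with pair' have "\<forall>\<^sub>F n in sequentially. wavelet_pair (Suc M) (a' n) (b' n)"
    proof eventually_elim
      case (elim n)
      have cd': "c' n k = (- y' n) * \<alpha>' n k + x' n * \<beta>' n k"
        "d' n k = x' n * \<alpha>' n k + y' n * \<beta>' n k" for k
        unfolding \<alpha>'_def \<beta>'_def using coords[OF elim(2)] by auto
      have zero: "\<alpha>' n k = 0" "\<beta>' n k = 0" if "k \<ge> M" for k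
        using elim(1) that by (simp_all add: \<alpha>'_def \<beta>'_def wavelet_pair_def)
      have "wavelet_pair M (\<lambda>k. (- y' n) * \<alpha>' n k + x' n * \<beta>' n k)
          (\<lambda>k. x' n * \<alpha>' n k + y' n * \<beta>' n k)"
        using elim(1) unfolding cd'[symmetric] .
      then show ?case
        unfolding a'_def b'_def by (subst wavelet_pair_shift_iff) (use zero in auto)
    qed
    \<comment> \<open>This holds for all \<open>n\<close>: where the denominator is zero, the
      quotients are 0 by convention.\<close>
    moreover have "a' n k \<in> \<rat> \<and> b' n k \<in> \<rat>" for n k
    proof -
      have \<alpha>r: "\<alpha>' n j \<in> \<rat>" and \<beta>r: "\<beta>' n j \<in> \<rat>" for j
        using rat' x' y' by (simp_all add: \<alpha>'_def \<beta>'_def)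
      have "shift (\<beta>' n) k \<in> \<rat>"
        using \<beta>r by (cases k) simp_all
      with \<alpha>r show ?thesis
        using x' y' by (simp add: a'_def b'_def)
    qed
    moreover have "(\<lambda>n. a' n k) \<longlonglongrightarrow> a k \<and> (\<lambda>n. b' n k) \<longlonglongrightarrow> b k" for k
    proof -
      \<comment> \<open>Solving for the coordinates in terms of \<open>c\<close> and
        \<open>d\<close> gives them the shape of \<open>\<alpha>'\<close> and
        \<open>\<beta>'\<close>, so the limits can be taken termwise.\<close>
      have \<alpha>_eq: "\<alpha> j = (- y * c j + x * d j) / (x\<^sup>2 + y\<^sup>2)"
        and \<beta>_eq: "\<beta> j = (x * c j + y * d j) / (x\<^sup>2 + y\<^sup>2)" for j
        using nz by (simp_all add: nonzero_eq_divide_eq)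
          (simp_all add: c_def d_def algebra_simps power2_eq_square)
      have \<alpha>l: "(\<lambda>n. \<alpha>' n j) \<longlonglongrightarrow> \<alpha> j" and \<beta>l: "(\<lambda>n. \<beta>' n j) \<longlonglongrightarrow> \<beta> j" for j
        unfolding \<alpha>_eq \<beta>_eq \<alpha>'_def \<beta>'_def by (intro tendsto_intros x' y' lim' nz)+
      have "(\<lambda>n. shift (\<beta>' n) k) \<longlonglongrightarrow> shift \<beta> k"
        using \<beta>l by (cases k) simp_all
      with \<alpha>l show ?thesis
        unfolding ab a'_def b'_def by (intro conjI tendsto_intros x' y')
    qed
    ultimately show ?thesis by blast
  qed
qed

section \<open>From wavelet matrices to pairs\<close>

lemma sum_even_odd:
  "(\<Sum>k<2 * N. of_real (if even k then a (k div 2) else b (k div 2)) * z ^ k)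
     = symbol N a (z\<^sup>2) + z * symbol N b (z\<^sup>2)"
  by (induction N) (simp_all add: symbol_def algebra_simps power_mult power2_eq_square power_mult_distrib)

lemma row_symbol_wavelet_matrix_0:
  "row_symbol (wavelet_matrix N a b) 0 z = symbol N a (z\<^sup>2) + z * symbol N b (z\<^sup>2)"
  unfolding sum_even_odd[symmetric] by (simp add: row_symbol_def wavelet_matrix_def)

text \<open>Reversing the order of the coefficients does not change a value at 1, so only the swap
  and the sign remain.\<close>

lemma row_symbol_wavelet_matrix_1:
  "row_symbol (wavelet_matrix N a b) 1 1 = symbol N a 1 - symbol N b 1"
proof -
  have "row_symbol (wavelet_matrix N a b) 1 1
      = symbol N (\<lambda>k. - b (N - 1 - k)) (1\<^sup>2) + 1 * symbol N (\<lambda>k. a (N - 1 - k)) (1\<^sup>2)"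
    unfolding sum_even_odd[symmetric] by (simp add: row_symbol_def wavelet_matrix_def)
  moreover have "symbol N (\<lambda>k. c (N - 1 - k)) 1 = symbol N c 1" for c
    unfolding symbol_def using sum.nat_diff_reindex[of "\<lambda>k. complex_of_real (c k)" N] by simp
  moreover have "symbol N (\<lambda>k. - c k) 1 = - symbol N c 1" for c
    by (simp add: symbol_def sum_negf)
  ultimately show ?thesis by simp
qed

text \<open>The parallelogram law turns the sum over z and -z into twice the squared norm of the
  pair at z^2, and every point of the circle is such a square.\<close>

lemma quadratic_condition_wavelet_matrix:
  "quadratic_condition (wavelet_matrix N a b) \<longleftrightarrow>
     (\<forall>z. cmod z = 1 \<longrightarrow> (cmod (symbol N a z))\<^sup>2 + (cmod (symbol N b z))\<^sup>2 = 2)"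
proof -
  have eq: "(cmod (row_symbol (wavelet_matrix N a b) 0 z))\<^sup>2
      + (cmod (row_symbol (wavelet_matrix N a b) 0 (- z)))\<^sup>2
      = 2 * ((cmod (symbol N a (z\<^sup>2)))\<^sup>2 + (cmod (symbol N b (z\<^sup>2)))\<^sup>2)" if "cmod z = 1" for z
  proof -
    have "(cmod (s + t))\<^sup>2 + (cmod (s - t))\<^sup>2 = 2 * ((cmod s)\<^sup>2 + (cmod t)\<^sup>2)" for s t
      unfolding cmod_power2 by (simp add: power2_eq_square algebra_simps)
    from this[of "symbol N a (z\<^sup>2)" "z * symbol N b (z\<^sup>2)"] show ?thesis
      using that by (simp add: row_symbol_wavelet_matrix_0 norm_mult)
  qed
  show ?thesis
  proof
    assume Q: "quadratic_condition (wavelet_matrix N a b)"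
    show "\<forall>z. cmod z = 1 \<longrightarrow> (cmod (symbol N a z))\<^sup>2 + (cmod (symbol N b z))\<^sup>2 = 2"
    proof (intro allI impI)
      fix z assume "cmod z = 1"
      then have "cmod (csqrt z) = 1" by simp
      from eq[OF this] Q this
      show "(cmod (symbol N a z))\<^sup>2 + (cmod (symbol N b z))\<^sup>2 = 2"
        by (simp add: quadratic_condition_def)
    qed
  next
    assume "\<forall>z. cmod z = 1 \<longrightarrow> (cmod (symbol N a z))\<^sup>2 + (cmod (symbol N b z))\<^sup>2 = 2"
    then show "quadratic_condition (wavelet_matrix N a b)"
      by (simp add: quadratic_condition_def eq norm_power)
  qed
qed

lemma linear_condition_wavelet_matrix:
  "linear_condition (wavelet_matrix N a b) \<longleftrightarrow> symbol N a 1 = 1 \<and> symbol N b 1 = 1"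
  unfolding linear_condition_def row_symbol_wavelet_matrix_0 row_symbol_wavelet_matrix_1
  by auto

theorem mainTheorem1:
  fixes N :: nat and a b :: "nat \<Rightarrow> real" and \<epsilon> :: real
  assumes "N \<ge> 1"
    and "quadratic_condition (wavelet_matrix N a b)"
    and "linear_condition (wavelet_matrix N a b)"
    and "polynomial_regularity (wavelet_matrix N a b) (N - 1)"
    and "\<epsilon> > 0"
  shows "\<exists>a' b' :: nat \<Rightarrow> rat.
           (\<forall>k<N. \<bar>real_of_rat (a' k) - a k\<bar> < \<epsilon> \<and> \<bar>real_of_rat (b' k) - b k\<bar> < \<epsilon>) \<and>
           quadratic_condition
             (wavelet_matrix N (\<lambda>k. real_of_rat (a' k)) (\<lambda>k. real_of_rat (b' k))) \<and>
           linear_condition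
             (wavelet_matrix N (\<lambda>k. real_of_rat (a' k)) (\<lambda>k. real_of_rat (b' k)))"
proof -
  \<comment> \<open>The matrix does not see values from \<open>N\<close> on, while
    \<open>wavelet_pair\<close> requires them to be zero.\<close>
  define a0 b0 where "a0 k = (if k < N then a k else 0)" and "b0 k = (if k < N then b k else 0)" for k
  have "symbol N a0 z = symbol N a z" "symbol N b0 z = symbol N b z" for z
    by (auto intro: symbol_cong simp: a0_def b0_def)
  then have "wavelet_pair N a0 b0"
    using assms by (simp add: wavelet_pair_def quadratic_condition_wavelet_matrix
        linear_condition_wavelet_matrix a0_def b0_def)
  from wavelet_pair_rational_sequence[OF this] obtain a' b' where
    pair: "\<forall>\<^sub>F n in sequentially. wavelet_pair N (a' n) (b' n)" and
    rat: "\<And>n k. a' n k \<in> \<rat>" "\<And>n k. b' n k \<in> \<rat>" and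
    lim: "\<And>k. (\<lambda>n. a' n k) \<longlonglongrightarrow> a0 k" "\<And>k. (\<lambda>n. b' n k) \<longlonglongrightarrow> b0 k"
    by blast
  have "\<forall>\<^sub>F n in sequentially. \<forall>k\<in>{..<N}. \<bar>a' n k - a0 k\<bar> < \<epsilon> \<and> \<bar>b' n k - b0 k\<bar> < \<epsilon>"
    using tendstoD[OF lim(1) \<open>\<epsilon> > 0\<close>] tendstoD[OF lim(2) \<open>\<epsilon> > 0\<close>]
    by (intro eventually_ball_finite ballI eventually_conj) (simp_all add: dist_real_def)
  with pair have "\<forall>\<^sub>F n in sequentially. wavelet_pair N (a' n) (b' n) \<and>
      (\<forall>k\<in>{..<N}. \<bar>a' n k - a0 k\<bar> < \<epsilon> \<and> \<bar>b' n k - b0 k\<bar> < \<epsilon>)"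
    by (rule eventually_conj)
  then obtain n where n: "wavelet_pair N (a' n) (b' n)"
    "\<forall>k\<in>{..<N}. \<bar>a' n k - a0 k\<bar> < \<epsilon> \<and> \<bar>b' n k - b0 k\<bar> < \<epsilon>"
    using eventually_happens'[OF sequentially_bot] by blast
  have "\<forall>k. \<exists>r. a' n k = real_of_rat r" "\<forall>k. \<exists>r. b' n k = real_of_rat r"
    using rat by (meson Rats_cases)+
  then obtain p q where pq: "\<And>k. a' n k = real_of_rat (p k)" "\<And>k. b' n k = real_of_rat (q k)"
    by metis
  have "wavelet_pair N (\<lambda>k. real_of_rat (p k)) (\<lambda>k. real_of_rat (q k))"
    using n(1) unfolding pq[symmetric] .
  then have "quadratic_condition (wavelet_matrix N (\<lambda>k. real_of_rat (p k)) (\<lambda>k. real_of_rat (q k)))"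
    "linear_condition (wavelet_matrix N (\<lambda>k. real_of_rat (p k)) (\<lambda>k. real_of_rat (q k)))"
    by (simp_all add: wavelet_pair_def quadratic_condition_wavelet_matrix
        linear_condition_wavelet_matrix)
  moreover have "\<forall>k<N. \<bar>real_of_rat (p k) - a k\<bar> < \<epsilon> \<and> \<bar>real_of_rat (q k) - b k\<bar> < \<epsilon>"
    using n(2) by (simp add: pq a0_def b0_def)
  ultimately show ?thesis by blast
qed

end
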